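(* For every super convex space $A$ that is an object of $\mathbf{SCvx}_{\star}$ there exists a measurable map, called the barycenter map, $\epsilon_A:\mathcal{G}(\mathbf{\Sigma}A)\to\mathbf{\Sigma}A$ such that (1) $\epsilon_A\circ\eta_{\mathbf{\Sigma}A}=1_{\mathbf{\Sigma}A}$; (2) $\epsilon_A\circ\mathcal{G}(\epsilon_A)=\epsilon_A\circ\epsilon_{\mathcal{G}(\mathbf{\Sigma}A)}$, where $\epsilon_{\mathcal{G}(\mathbf{\Sigma}A)}:=\mu_{\mathbf{\Sigma}A}$; (3) $\epsilon_A$ is a countably affine map. (Taken together, the first two properties are equivalent to saying that $\epsilon_A$ is a $\mathcal{G}$-algebra.)
   Context: Super convex spaces. $\mathbb{N}=\{0,1,2,\dots\}$; as a measurable space it carries the powerset $\sigma$-algebra. $\mathcal{G}\mathbb{N}$ is the set of sequences $\mathbf{p}:\mathbb{N}\to[0,1]$ with $\sum_i p_i=1$, identified with the probability measures $\sum_i p_i\delta_i$ on $\mathbb{N}$. A super convex space is a set $A$ with a function $\mathcal{G}\mathbb{N}\times A^{\mathbb{N}}\to A$, $(\mathbf{p},\mathbf{a})\mapsto\sum_{i\in\mathbb{N}}p_ia_i$, such that (1) for $\mathbf{p}=\delta_j$ the value is $a_j$, and (2) $\sum_j p_j(\sum_i Q^j_i a_i)=\sum_i(\sum_j p_jQ^j_i)a_i$ for all $\mathbf{p}\in\mathcal{G}\mathbb{N}$, all sequences $\mathbf{Q}:\mathbb{N}\to\mathcal{G}\mathbb{N}$ and all $\mathbf{a}:\mathbb{N}\to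 A$. A countably affine map is a function $m$ with $m(\sum_i p_ia_i)=\sum_i p_i m(a_i)$ always. Super convex spaces and countably affine maps form the category $\mathbf{SCvx}$. $\Delta_{\mathbb{N}}$ is the set $\mathcal{G}\mathbb{N}$ as a super convex space with countably affine sums taken coefficientwise. $\mathsf{N}$ is the set of natural numbers with super convex structure $\sum_i p_iu_i=\min\{u_i\mid p_i>0\}$. $\mathbf{\Omega}$ is the full subcategory of $\mathbf{SCvx}$ on the two objects $\mathsf{N}$ and $\Delta_{\mathbb{N}}$, with inclusion $\iota:\mathbf{\Omega}\to\mathbf{SCvx}$. Standard measurable spaces. A basis for a field $\mathcal{F}$ of subsets of $X$ is an increasing sequence of finite fields $F_1\subseteq F_2\subseteq\cdots$ with $\mathcal{F}=\bigcup_n F_n$ such that whenever $G_n$ is an atom of $F_n$ with $G_{n+1}\subseteq G_n$ for all $n$, then $\bigcap_n G_n\neq\emptyset$. A measurable space $(X,\Sigma_X)$ is standard if $\Sigma_X=\sigma(\mathcal{F})$ for some field $\mathcal{F}$ possessing a basis. It is separated if any two distinct points are separated by a measurable set. $\mathbf{Std}_2$ is the category of separated standard measurable spaces and measurable maps, $\mathbf{Meas}$ the category of all measurable spaces. Giry monad. $\mathcal{G}X$ is the set of probability measures on $X$ with the smallest $\sigma$-algebra making all evaluations $ev_U:P\mapsto P(U)$, $U\in\Sigma_X$, measurable; $\mathcal{G}f$ is push-forward; $\eta_X(x)=\delta_x$; $\mu_X(Q)(U)=\int_{P\in\mathcal{G}X}P(U)\,dQ$. A $\mathcal{G}$-algebra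 is a measurable map $h:\mathcal{G}X\to X$ with $h\circ\eta_X=1_X$ and $h\circ\mathcal{G}h=h\circ\mu_X$. Functors. Let $\mathbf{\Sigma}'':\mathbf{\Omega}\to\mathbf{Meas}$ be the functor $\mathsf{N}\mapsto\mathbb{N}$, $\Delta_{\mathbb{N}}\mapsto\mathcal{G}\mathbb{N}$, sending maps to their underlying functions. Its right Kan extension along $\iota$ is computed pointwise as $Ran_{\iota}(\mathbf{\Sigma}'')(A)=\lim\big(A\downarrow\iota\to\mathbf{\Omega}\xrightarrow{\mathbf{\Sigma}''}\mathbf{Meas}\big)$. $\mathbf{SCvx}_{\star}$ is the pullback of $Ran_{\iota}(\mathbf{\Sigma}''):\mathbf{SCvx}\to\mathbf{Meas}$ along $\mathbf{Std}_2\hookrightarrow\mathbf{Meas}$, i.e. the full subcategory of $\mathbf{SCvx}$ of those $A$ with $Ran_{\iota}(\mathbf{\Sigma}'')(A)$ a separated standard measurable space, and $\mathbf{\Sigma}:\mathbf{SCvx}_{\star}\to\mathbf{Std}_2$ is the resulting restriction of $Ran_{\iota}(\mathbf{\Sigma}'')$. By convention the underlying set of $\mathbf{\Sigma}A$ is identified with that of $A$ ($\mathbf{\Sigma}$ forgets the super convex structure and endows the set with a $\sigma$-algebra), and "countably affine" in (3) refers to $\epsilon_A$ as a map to $A$ from the super convex space of probability measures on $\mathbf{\Sigma}A$ with $(\sum_i p_iP_i)(U)=\sum_i p_iP_i(U)$.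
   Formalization: The convention that ΣA and A share one underlying set can fail (A=[0,∞]: ΣA has two points), so the claim on A itself assumes the canonical map A→Ran_ι(Σ'')(A) is bijective; for all other A it is proved on Ran_ι(Σ'')(A) with componentwise sums. *)

theory Defs
  imports "HOL-Probability.Probability"
begin

text \<open>
  A sequence in $[0,1]$ indexed by the natural numbers with sum $1$ is an element of
  \<^typ>\<open>nat pmf\<close>: $p_i$ is \<open>pmf p i\<close>, $\delta_j$ is \<open>return_pmf j\<close>, the set of $i$ with $p_i > 0$
  is \<open>set_pmf p\<close>, and the mixture with coefficients $\sum_j p_j Q^j_i$ is \<open>bind_pmf p Q\<close>.
\<close>

lemma pmf_bind_nat_sums:
  fixes p :: "nat pmf"
  shows "(\<lambda>j. pmf p j * pmf (Q j) i) sums pmf (bind_pmf p Q) i"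
proof -
  have "integrable (measure_pmf p) (\<lambda>j. pmf (Q j) i)"
    by (rule measure_pmf.integrable_const_bound[where B = 1]) (auto simp: pmf_le_1)
  then have "integrable (count_space UNIV) (\<lambda>j. pmf p j *\<^sub>R pmf (Q j) i)"
    unfolding measure_pmf_eq_density
    by (subst (asm) integrable_density) (auto simp: pmf_nonneg)
  from sums_integral_count_space_nat[OF this]
  have "(\<lambda>j. pmf p j * pmf (Q j) i) sums
      (\<integral>j. pmf p j *\<^sub>R pmf (Q j) i \<partial>count_space UNIV)" by simp
  also have "(\<integral>j. pmf p j *\<^sub>R pmf (Q j) i \<partial>count_space UNIV) = pmf (bind_pmf p Q) i"
    unfolding pmf_bind unfolding measure_pmf_eq_density
    by (subst integral_density) (auto simp: pmf_nonneg)
  finally show ?thesis .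
qed

section \<open>Super convex spaces\<close>

record 'a scvx =
  pts :: "'a set"
  csum :: "nat pmf \<Rightarrow> (nat \<Rightarrow> 'a) \<Rightarrow> 'a"

definition super_convex_space :: "'a scvx \<Rightarrow> bool" where
  "super_convex_space A \<longleftrightarrow>
     (\<forall>p. \<forall>a \<in> UNIV \<rightarrow> pts A. csum A p a \<in> pts A) \<and>
     (\<forall>j. \<forall>a \<in> UNIV \<rightarrow> pts A. csum A (return_pmf j) a = a j) \<and>
     (\<forall>p Q. \<forall>a \<in> UNIV \<rightarrow> pts A.
        csum A p (\<lambda>j. csum A (Q j) a) = csum A (bind_pmf p Q) a)"

definition countably_affine :: "'a scvx \<Rightarrow> 'b scvx \<Rightarrow> ('a \<Rightarrow> 'b) \<Rightarrow> bool" where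
  "countably_affine A B m \<longleftrightarrow>
     m \<in> pts A \<rightarrow> pts B \<and>
     (\<forall>p. \<forall>a \<in> UNIV \<rightarrow> pts A. m (csum A p a) = csum B p (\<lambda>i. m (a i)))"

text \<open>Morphisms are extensional functions, so that two of them are equal as soon as they agree
  on the underlying set.\<close>

definition hom_scvx :: "'a scvx \<Rightarrow> 'b scvx \<Rightarrow> ('a \<Rightarrow> 'b) set" where
  "hom_scvx A B = {m \<in> extensional (pts A). countably_affine A B m}"

definition DeltaN :: "nat pmf scvx" where
  "DeltaN = \<lparr>pts = UNIV, csum = bind_pmf\<rparr>"

definition NatMin :: "nat scvx" where
  "NatMin = \<lparr>pts = UNIV, csum = (\<lambda>p u. LEAST n. n \<in> u ` set_pmf p)\<rparr>"

lemma super_convex_space_DeltaN: "super_convex_space DeltaN"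
  by (simp add: super_convex_space_def DeltaN_def bind_return_pmf bind_assoc_pmf)

lemma super_convex_space_NatMin: "super_convex_space NatMin"
proof -
  define l where "l f q = (LEAST n. n \<in> f ` set_pmf q)" for f :: "nat \<Rightarrow> nat" and q
  have l_in: "l f q \<in> f ` set_pmf q" for f q
  proof -
    obtain k where "k \<in> set_pmf q" using set_pmf_not_empty[of q] by blast
    then show ?thesis unfolding l_def by (rule LeastI[OF imageI])
  qed
  have l_le: "l f q \<le> f k" if "k \<in> set_pmf q" for f q k
    unfolding l_def by (rule Least_le) (rule imageI[OF that])
  have l_bind: "l (\<lambda>j. l a (Q j)) p = l a (bind_pmf p Q)" for p Q a
  proof (rule antisym)
    obtain k j where k: "l a (bind_pmf p Q) = a k" "j \<in> set_pmf p" "k \<in> set_pmf (Q j)"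
      using l_in[of a "bind_pmf p Q"] unfolding set_bind_pmf by (elim imageE UN_E)
    show "l (\<lambda>j. l a (Q j)) p \<le> l a (bind_pmf p Q)"
      unfolding k(1) by (rule order_trans[OF l_le[OF k(2), of "\<lambda>j. l a (Q j)"] l_le[OF k(3), of a]])
    obtain j' where j': "l (\<lambda>j. l a (Q j)) p = l a (Q j')" "j' \<in> set_pmf p"
      using l_in[of "\<lambda>j. l a (Q j)" p] by (rule imageE)
    obtain k' where k': "l a (Q j') = a k'" "k' \<in> set_pmf (Q j')"
      using l_in[of a "Q j'"] by (rule imageE)
    have "k' \<in> set_pmf (bind_pmf p Q)"
      unfolding set_bind_pmf using j'(2) k'(2) by (rule UN_I)
    then show "l a (bind_pmf p Q) \<le> l (\<lambda>j. l a (Q j)) p"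
      unfolding j'(1) k'(1) by (rule l_le)
  qed
  have l_return: "l a (return_pmf j) = a j" for a j
    using l_in[of a "return_pmf j"] by (simp only: set_return_pmf image_insert image_empty singleton_iff)
  have N: "NatMin = \<lparr>pts = UNIV, csum = (\<lambda>p u. l u p)\<rparr>"
    unfolding NatMin_def l_def ..
  have csum: "csum NatMin = (\<lambda>p u. l u p)" and pts: "pts NatMin = UNIV"
    by (simp_all only: N scvx.select_convs)
  show ?thesis
    unfolding super_convex_space_def csum pts
    by (intro conjI allI ballI) (rule UNIV_I l_return l_bind)+
qed

section \<open>Separated standard measurable spaces\<close>

definition atom_of :: "'a set set \<Rightarrow> 'a set \<Rightarrow> bool" where
  "atom_of F G \<longleftrightarrow> G \<in> F \<and> G \<noteq> {} \<and> (\<forall>H\<in>F. H \<subseteq> G \<longrightarrow> H = {} \<or> H = G)"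

definition field_basis :: "'a set \<Rightarrow> 'a set set \<Rightarrow> (nat \<Rightarrow> 'a set set) \<Rightarrow> bool" where
  "field_basis X \<F> F \<longleftrightarrow>
     (\<forall>n. algebra X (F n) \<and> finite (F n) \<and> F n \<subseteq> F (Suc n)) \<and>
     \<F> = (\<Union>n. F n) \<and>
     (\<forall>G. (\<forall>n. atom_of (F n) (G n) \<and> G (Suc n) \<subseteq> G n) \<longrightarrow> (\<Inter>n. G n) \<noteq> {})"

definition standard_space :: "'a measure \<Rightarrow> bool" where
  "standard_space M \<longleftrightarrow>
     (\<exists>\<F>. algebra (space M) \<F> \<and> (\<exists>F. field_basis (space M) \<F> F) \<and>
           sets M = sigma_sets (space M) \<F>)"

definition separated_space :: "'a measure \<Rightarrow> bool" where
  "separated_space M \<longleftrightarrow>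
     (\<forall>x\<in>space M. \<forall>y\<in>space M. x \<noteq> y \<longrightarrow> (\<exists>U\<in>sets M. x \<in> U \<and> y \<notin> U))"

section \<open>The right Kan extension\<close>

text \<open>The Giry space of the discrete space of natural numbers, on sequences of coefficients.\<close>

definition GirySeq :: "nat pmf measure" where
  "GirySeq = vimage_algebra UNIV measure_pmf (prob_algebra (count_space UNIV))"

text \<open>
  A point of the limit over the comma category of \<open>A\<close> is a family indexed by the objects of that
  category, i.e. by all countably affine maps from \<open>A\<close> to \<^const>\<open>NatMin\<close> (first component) and
  to \<^const>\<open>DeltaN\<close> (second component); a morphism from \<open>f\<close> to \<open>f'\<close> is a countably affine \<open>g\<close>
  with $f' = g \circ f$.
\<close>

type_synonym 'a family = "(('a \<Rightarrow> nat) \<Rightarrow> nat) \<times> (('a \<Rightarrow> nat pmf) \<Rightarrow> nat pmf)"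

definition compatible :: "'a scvx \<Rightarrow> 'a family \<Rightarrow> bool" where
  "compatible A x \<longleftrightarrow>
     (\<forall>f\<in>hom_scvx A NatMin. \<forall>g\<in>hom_scvx NatMin NatMin.
        fst x (compose (pts A) g f) = g (fst x f)) \<and>
     (\<forall>f\<in>hom_scvx A NatMin. \<forall>g\<in>hom_scvx NatMin DeltaN.
        snd x (compose (pts A) g f) = g (fst x f)) \<and>
     (\<forall>f\<in>hom_scvx A DeltaN. \<forall>g\<in>hom_scvx DeltaN NatMin.
        fst x (compose (pts A) g f) = g (snd x f)) \<and>
     (\<forall>f\<in>hom_scvx A DeltaN. \<forall>g\<in>hom_scvx DeltaN DeltaN.
        snd x (compose (pts A) g f) = g (snd x f))"

definition Ran :: "'a scvx \<Rightarrow> 'a family measure" where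
  "Ran A = restrict_space
     ((\<Pi>\<^sub>M f\<in>hom_scvx A NatMin. count_space UNIV) \<Otimes>\<^sub>M (\<Pi>\<^sub>M f\<in>hom_scvx A DeltaN. GirySeq))
     {x. compatible A x}"

text \<open>The same limit taken in super convex spaces: the sums are formed componentwise.\<close>

definition Ran_scvx :: "'a scvx \<Rightarrow> 'a family scvx" where
  "Ran_scvx A =
     \<lparr>pts = space (Ran A),
      csum = (\<lambda>p x. (\<lambda>f\<in>hom_scvx A NatMin. csum NatMin p (\<lambda>i. fst (x i) f),
                     \<lambda>f\<in>hom_scvx A DeltaN. csum DeltaN p (\<lambda>i. snd (x i) f)))\<rparr>"

text \<open>The map into the limit induced by the cone of all countably affine maps out of \<open>A\<close>.\<close>

definition comparison :: "'a scvx \<Rightarrow> 'a \<Rightarrow> 'a family" where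
  "comparison A a = (\<lambda>f\<in>hom_scvx A NatMin. f a, \<lambda>f\<in>hom_scvx A DeltaN. f a)"

definition SCvx_star :: "'a scvx \<Rightarrow> bool" where
  "SCvx_star A \<longleftrightarrow>
     super_convex_space A \<and> separated_space (Ran A) \<and> standard_space (Ran A)"

text \<open>
  The identification of the set underlying the limit with the set underlying \<open>A\<close>. It does not
  hold for every super convex space: the extended half-line $[0,\infty]$ has only two points that
  countably affine maps into \<^const>\<open>NatMin\<close> and \<^const>\<open>DeltaN\<close> can tell apart, and for the
  four-element lattice $\{0,1\}^2$ with infima as sums the limit has five points.
\<close>

definition identified :: "'a scvx \<Rightarrow> bool" where
  "identified A \<longleftrightarrow> bij_betw (comparison A) (pts A) (space (Ran A))"

text \<open>The $\sigma$-algebra of the limit, transported to the set underlying \<open>A\<close>.\<close>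

definition Sigma_space :: "'a scvx \<Rightarrow> 'a measure" where
  "Sigma_space A = vimage_algebra (pts A) (comparison A) (Ran A)"

lemma countably_affine_compose:
  assumes f: "countably_affine A B f" and g: "countably_affine B C g"
  shows "countably_affine A C (\<lambda>x. g (f x))"
  unfolding countably_affine_def
proof (intro conjI allI ballI)
  have fm: "\<And>x. x \<in> pts A \<Longrightarrow> f x \<in> pts B" and gm: "\<And>y. y \<in> pts B \<Longrightarrow> g y \<in> pts C"
    using f g unfolding countably_affine_def by blast+
  then show "(\<lambda>x. g (f x)) \<in> pts A \<rightarrow> pts C" by blast
  fix p and a :: "nat \<Rightarrow> _" assume a: "a \<in> UNIV \<rightarrow> pts A"
  have b: "(\<lambda>i. f (a i)) \<in> UNIV \<rightarrow> pts B" using a fm by blast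
  have "f (csum A p a) = csum B p (\<lambda>i. f (a i))"
    using f a unfolding countably_affine_def by blast
  moreover have "g (csum B p (\<lambda>i. f (a i))) = csum C p (\<lambda>i. g (f (a i)))"
    using g b unfolding countably_affine_def by blast
  ultimately show "g (f (csum A p a)) = csum C p (\<lambda>i. g (f (a i)))" by metis
qed

lemma csum_closed:
  "super_convex_space A \<Longrightarrow> a \<in> UNIV \<rightarrow> pts A \<Longrightarrow> csum A p a \<in> pts A"
  unfolding super_convex_space_def by blast

lemma compose_hom_scvx:
  assumes A: "super_convex_space A" and f: "f \<in> hom_scvx A B" and g: "g \<in> hom_scvx B C"
  shows "compose (pts A) g f \<in> hom_scvx A C"
proof -
  have c: "countably_affine A C (\<lambda>x. g (f x))"
    using f g unfolding hom_scvx_def by (blast intro: countably_affine_compose)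
  have on: "compose (pts A) g f x = g (f x)" if "x \<in> pts A" for x
    using that by (simp add: compose_def)
  have "countably_affine A C (compose (pts A) g f)"
    unfolding countably_affine_def
  proof (intro conjI allI ballI)
    show "compose (pts A) g f \<in> pts A \<rightarrow> pts C"
    proof
      fix x assume x: "x \<in> pts A"
      then have "g (f x) \<in> pts C" using c unfolding countably_affine_def by blast
      then show "compose (pts A) g f x \<in> pts C" by (simp only: on[OF x])
    qed
    fix p and a :: "nat \<Rightarrow> _" assume a: "a \<in> UNIV \<rightarrow> pts A"
    have ai: "a i \<in> pts A" for i using a by blast
    have "g (f (csum A p a)) = csum C p (\<lambda>i. g (f (a i)))"
      using c a unfolding countably_affine_def by blast
    then show "compose (pts A) g f (csum A p a) = csum C p (\<lambda>i. compose (pts A) g f (a i))"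
      by (simp only: on[OF csum_closed[OF A a]] on[OF ai])
  qed
  then show ?thesis
    unfolding hom_scvx_def by (intro CollectI conjI compose_extensional)
qed

lemma comparison_in_Ran:
  assumes A: "super_convex_space A" and a: "a \<in> pts A"
  shows "comparison A a \<in> space (Ran A)"
proof -
  have "compatible A (comparison A a)"
    unfolding compatible_def comparison_def
    by (intro conjI ballI) (simp_all only: fst_conv snd_conv restrict_apply' compose_hom_scvx[OF A]
        compose_eq[OF a])
  then show ?thesis
    by (simp add: Ran_def space_restrict_space space_pair_measure space_PiM comparison_def
        GirySeq_def)
qed

text \<open>Under the identification, the componentwise sums are the sums of \<open>A\<close>.\<close>

lemma countably_affine_comparison:
  assumes A: "super_convex_space A"
  shows "countably_affine A (Ran_scvx A) (comparison A)"
  unfolding countably_affine_def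
proof (intro conjI allI ballI)
  show "comparison A \<in> pts A \<rightarrow> pts (Ran_scvx A)"
    using comparison_in_Ran[OF A] by (simp add: Ran_scvx_def)
  fix p and a :: "nat \<Rightarrow> 'a" assume a: "a \<in> UNIV \<rightarrow> pts A"
  have *: "f (csum A p a) = csum B p (\<lambda>i. f (a i))" if "f \<in> hom_scvx A B"
    for f and B :: "'c scvx"
    using that a unfolding hom_scvx_def countably_affine_def by blast
  show "comparison A (csum A p a) = csum (Ran_scvx A) p (\<lambda>i. comparison A (a i))"
    unfolding comparison_def Ran_scvx_def
    by (simp add: * cong: restrict_cong)
qed

section \<open>The Giry monad\<close>

text \<open>
  The Giry space of \<open>M\<close> is \<open>prob_algebra M\<close>, the unit is \<open>return M\<close> and push-forward is
  \<^const>\<open>distr\<close>. The library's \<^const>\<open>join\<close> recovers the base space from the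
  $\sigma$-algebra of a space of subprobability measures and cannot be applied to measures on
  \<open>prob_algebra M\<close>.
\<close>

definition giry_mult :: "'a measure \<Rightarrow> 'a measure measure \<Rightarrow> 'a measure" where
  "giry_mult M Q = measure_of (space M) (sets M) (\<lambda>U. \<integral>\<^sup>+ P. emeasure P U \<partial>Q)"

definition giry_algebra :: "'a measure \<Rightarrow> ('a measure \<Rightarrow> 'a) \<Rightarrow> bool" where
  "giry_algebra M h \<longleftrightarrow>
     h \<in> prob_algebra M \<rightarrow>\<^sub>M M \<and>
     restrict (h \<circ> return M) (space M) = restrict id (space M) \<and>
     restrict (h \<circ> (\<lambda>Q. distr Q M h)) (space (prob_algebra (prob_algebra M))) =
     restrict (h \<circ> giry_mult M) (space (prob_algebra (prob_algebra M)))"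

definition Giry_scvx :: "'a measure \<Rightarrow> 'a measure scvx" where
  "Giry_scvx M =
     \<lparr>pts = space (prob_algebra M),
      csum = (\<lambda>p P. measure_of (space M) (sets M)
                       (\<lambda>U. \<Sum>i. ennreal (pmf p i) * emeasure (P i) U))\<rparr>"

definition barycenter_unit :: "'a measure \<Rightarrow> ('a measure \<Rightarrow> 'a) \<Rightarrow> bool" where
  "barycenter_unit M \<epsilon> \<longleftrightarrow> (\<forall>x\<in>space M. \<epsilon> (return M x) = x)"

definition barycenter_mult :: "'a measure \<Rightarrow> ('a measure \<Rightarrow> 'a) \<Rightarrow> bool" where
  "barycenter_mult M \<epsilon> \<longleftrightarrow>
     (\<forall>Q\<in>space (prob_algebra (prob_algebra M)). \<epsilon> (distr Q M \<epsilon>) = \<epsilon> (giry_mult M Q))"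

end

theory Submission
  imports Defs
begin

text \<open>
  A point of the limit is a family of coordinates in the two test spaces, and each test space has a
  canonical notion of average over an arbitrary probability measure, not only over a countable
  convex combination. In $\Delta_{\mathbb{N}}$ it is the coefficientwise integral, the Kleisli
  composite of the measure with the random sequence; in $\mathsf{N}$ it is the essential minimum,
  the largest lower bound that holds almost surely. The barycenter of a probability measure on the
  limit averages every coordinate in this sense.

  The averages have to form a compatible family again, which asks that a countably affine map $g$
  between test spaces commutes with averaging, although $g$ is only known to respect countable
  sums. A random element of $\mathsf{N}$ has a law in $\mathcal{G}\mathbb{N}$, so its average is
  already a countable sum. A map $g$ out of $\Delta_{\mathbb{N}}$ is determined by its values
  $\gamma_i = g(\delta_i)$, and $g(p)$ is the average of $\gamma$ under $p$; commuting with $g$ is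
  then the associativity of averaging: averaging under a mixture of measures is averaging the
  averages (\<open>ess_min_bind\<close>, \<open>mean_pmf_bind\<close>).

  The same associativity (\<open>average_bind\<close>) yields the multiplication law and affineness, since
  $\mu$ and the countable convex combinations of measures are both monadic binds: the former along the identity kernel,
  the latter along a kernel on $\mathbb{N}$. Where the limit is identified with $A$, everything is
  transported along the comparison bijection, which respects the sums and is an isomorphism of
  measurable spaces by the choice of the $\sigma$-algebra on $A$.
\<close>

section \<open>Essential minima\<close>

definition ess_min :: "'w measure \<Rightarrow> ('w \<Rightarrow> nat) \<Rightarrow> nat" where
  "ess_min M u = (LEAST n. \<not> (AE \<omega> in M. n < u \<omega>))"

text \<open>
  If every $n$ were almost surely below \<open>u\<close>, countable additivity would put all of them below it at
  once, so the least $n$ that fails to be a strict lower bound exists; the strict lower bounds are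
  downward closed.
\<close>
lemma less_ess_min_iff:
  assumes "prob_space M"
  shows "n < ess_min M u \<longleftrightarrow> (AE \<omega> in M. n < u \<omega>)"
proof -
  interpret prob_space M by fact
  have "\<exists>n. \<not> (AE \<omega> in M. n < u \<omega>)"
  proof (rule ccontr)
    assume "\<not> ?thesis"
    then have "AE \<omega> in M. \<forall>n. n < u \<omega>" by (simp add: AE_all_countable)
    then have "AE \<omega> in M. False" by (rule AE_mp) (auto intro!: AE_I2)
    then show False by simp
  qed
  then have L: "\<not> (AE \<omega> in M. ess_min M u < u \<omega>)"
    unfolding ess_min_def by (rule LeastI_ex)
  show ?thesis
  proof
    assume "n < ess_min M u"
    then show "AE \<omega> in M. n < u \<omega>"
      unfolding ess_min_def using not_less_Least by blast
  next
    assume n: "AE \<omega> in M. n < u \<omega>"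
    show "n < ess_min M u"
    proof (rule ccontr)
      assume "\<not> ?thesis"
      then have "AE \<omega> in M. ess_min M u < u \<omega>" using n by (auto elim!: AE_mp)
      then show False using L by blast
    qed
  qed
qed

lemma nat_eqI_less: "(\<And>n::nat. n < a \<longleftrightarrow> n < b) \<Longrightarrow> a = b"
  by (meson linorder_neqE_nat less_irrefl)

lemma ess_min_cong:
  "(\<And>\<omega>. \<omega> \<in> space M \<Longrightarrow> u \<omega> = v \<omega>) \<Longrightarrow> ess_min M u = ess_min M v"
  unfolding ess_min_def by (simp cong: AE_cong)

text \<open>
  ``Almost surely'' is transitive along a kernel, and hence so is being an almost sure lower bound.
\<close>
lemma ess_min_bind:
  assumes Q: "Q \<in> space (prob_algebra N)" and K: "K \<in> N \<rightarrow>\<^sub>M prob_algebra M"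
    and u: "u \<in> M \<rightarrow>\<^sub>M count_space UNIV"
  shows "ess_min (Q \<bind> K) u = ess_min Q (\<lambda>\<omega>. ess_min (K \<omega>) u)"
proof (rule nat_eqI_less)
  fix n
  have Q': "prob_space Q" "sets Q = sets N" using Q by (auto simp: space_prob_algebra)
  have K': "K \<in> Q \<rightarrow>\<^sub>M subprob_algebra M"
    using measurable_prob_algebraD[OF K] Q'(2) by (simp cong: measurable_cong_sets)
  have P: "prob_space (K \<omega>)" if "\<omega> \<in> space Q" for \<omega>
    using measurable_space[OF K] that sets_eq_imp_space_eq[OF Q'(2)]
    by (auto simp: space_prob_algebra)
  have "n < ess_min (Q \<bind> K) u \<longleftrightarrow> (AE \<omega> in Q \<bind> K. n < u \<omega>)"
    by (rule less_ess_min_iff[OF prob_space_bind'[OF Q K]])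
  also have "\<dots> \<longleftrightarrow> (AE \<omega> in Q. AE y in K \<omega>. n < u y)"
    using u by (intro AE_bind[OF K']) measurable
  also have "\<dots> \<longleftrightarrow> (AE \<omega> in Q. n < ess_min (K \<omega>) u)"
    by (intro AE_cong) (simp add: less_ess_min_iff[OF P])
  also have "\<dots> \<longleftrightarrow> n < ess_min Q (\<lambda>\<omega>. ess_min (K \<omega>) u)"
    by (rule less_ess_min_iff[OF Q'(1), symmetric])
  finally show "n < ess_min (Q \<bind> K) u \<longleftrightarrow> n < ess_min Q (\<lambda>\<omega>. ess_min (K \<omega>) u)" .
qed

lemma ess_min_distr:
  assumes g: "g \<in> M \<rightarrow>\<^sub>M N" and u: "u \<in> N \<rightarrow>\<^sub>M count_space UNIV"
  shows "ess_min (distr M N g) u = ess_min M (\<lambda>\<omega>. u (g \<omega>))"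
proof -
  have "{x \<in> space N. n < u x} \<in> sets N" for n
    using u by measurable
  then show ?thesis unfolding ess_min_def by (simp add: AE_distr_iff[OF g])
qed

lemma ess_min_return:
  assumes "x \<in> space M" and u: "u \<in> M \<rightarrow>\<^sub>M count_space UNIV"
  shows "ess_min (return M x) u = u x"
proof (rule nat_eqI_less)
  fix n
  have "Measurable.pred M (\<lambda>x. n < u x)" using u by measurable
  then show "n < ess_min (return M x) u \<longleftrightarrow> n < u x"
    by (simp add: less_ess_min_iff[OF prob_space_return[OF assms(1)]] AE_return[OF assms(1)])
qed

lemma ess_min_pmf: "ess_min (measure_pmf p) u = csum NatMin p u"
proof -
  define m where "m = (LEAST n. n \<in> u ` set_pmf p)"
  obtain k where "k \<in> set_pmf p" using set_pmf_not_empty[of p] by blast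
  then have 1: "m \<in> u ` set_pmf p" unfolding m_def by (rule LeastI[OF imageI])
  have 2: "m \<le> u i" if "i \<in> set_pmf p" for i
    unfolding m_def using that by (intro Least_le imageI)
  have "ess_min (measure_pmf p) u = m"
  proof (rule nat_eqI_less)
    fix n
    show "n < ess_min (measure_pmf p) u \<longleftrightarrow> n < m"
      using 1 2
      by (auto simp: less_ess_min_iff[OF measure_pmf.prob_space_axioms] AE_measure_pmf_iff
          intro: less_le_trans)
  qed
  then show ?thesis by (simp add: NatMin_def m_def)
qed

text \<open>
  Being a strict lower bound almost surely is the vanishing of an evaluation, and evaluations
  generate the $\sigma$-algebra on probability measures.
\<close>
lemma measurable_ess_min:
  assumes u: "u \<in> M \<rightarrow>\<^sub>M count_space UNIV"
  shows "(\<lambda>P. ess_min P u) \<in> prob_algebra M \<rightarrow>\<^sub>M count_space UNIV"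
  unfolding ess_min_def
proof (rule measurable_Least)
  fix n
  let ?S = "{x \<in> space M. \<not> n < u x}"
  have S: "?S \<in> sets M" using u by measurable
  have [measurable]: "(\<lambda>P. measure P ?S) \<in> borel_measurable (prob_algebra M)"
    by (rule measurable_measure_prob_algebra[OF S])
  have "\<not> (AE \<omega> in P. n < u \<omega>) \<longleftrightarrow> measure P ?S \<noteq> 0"
    if P: "P \<in> space (prob_algebra M)" for P
  proof -
    interpret prob_space P using P by (simp add: space_prob_algebra)
    have s: "sets P = sets M" using P by (simp add: space_prob_algebra)
    have "(AE \<omega> in P. n < u \<omega>) \<longleftrightarrow> emeasure P ?S = 0"
      by (rule AE_iff_measurable) (simp_all only: s S sets_eq_imp_space_eq[OF s])
    then show ?thesis by (simp add: emeasure_eq_measure)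
  qed
  then have "Measurable.pred (prob_algebra M) (\<lambda>P. \<not> (AE \<omega> in P. n < u \<omega>)) \<longleftrightarrow>
      Measurable.pred (prob_algebra M) (\<lambda>P. measure P ?S \<noteq> 0)"
    by (rule measurable_cong)
  moreover have "Measurable.pred (prob_algebra M) (\<lambda>P. measure P ?S \<noteq> 0)"
    by measurable
  ultimately show "Measurable.pred (prob_algebra M) (\<lambda>P. \<not> (AE \<omega> in P. n < u \<omega>))"
    by (rule iffD2)
qed

section \<open>Means of random sequences of coefficients\<close>

definition mean_pmf :: "'w measure \<Rightarrow> ('w \<Rightarrow> nat pmf) \<Rightarrow> nat pmf" where
  "mean_pmf M q = Abs_pmf (M \<bind> (\<lambda>\<omega>. measure_pmf (q \<omega>)))"

text \<open>
  \<^const>\<open>GirySeq\<close> carries the initial $\sigma$-algebra for \<^const>\<open>measure_pmf\<close>, so random sequences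
  of coefficients are the same as kernels into the natural numbers.
\<close>
lemma measurable_GirySeq_iff:
  "q \<in> M \<rightarrow>\<^sub>M GirySeq \<longleftrightarrow>
     (\<lambda>\<omega>. measure_pmf (q \<omega>)) \<in> M \<rightarrow>\<^sub>M prob_algebra (count_space UNIV)"
proof
  have "measure_pmf \<in> GirySeq \<rightarrow>\<^sub>M prob_algebra (count_space UNIV)"
    unfolding GirySeq_def
    by (rule measurable_vimage_algebra1)
       (auto simp: space_prob_algebra measure_pmf.prob_space_axioms)
  then show "(\<lambda>\<omega>. measure_pmf (q \<omega>)) \<in> M \<rightarrow>\<^sub>M prob_algebra (count_space UNIV)"
    if "q \<in> M \<rightarrow>\<^sub>M GirySeq"
    by (rule measurable_compose[OF that])
next
  assume "(\<lambda>\<omega>. measure_pmf (q \<omega>)) \<in> M \<rightarrow>\<^sub>M prob_algebra (count_space UNIV)"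
  then show "q \<in> M \<rightarrow>\<^sub>M GirySeq"
    unfolding GirySeq_def by (intro measurable_vimage_algebra2) auto
qed

lemma measure_mean_pmf:
  assumes M: "prob_space M" and q: "q \<in> M \<rightarrow>\<^sub>M GirySeq"
  shows "measure_pmf (mean_pmf M q) = M \<bind> (\<lambda>\<omega>. measure_pmf (q \<omega>))" (is "_ = ?B")
proof -
  have M': "M \<in> space (prob_algebra M)" using M by (simp add: space_prob_algebra)
  note q' = q[unfolded measurable_GirySeq_iff]
  have p: "prob_space ?B" and s: "sets ?B = UNIV"
    using prob_space_bind'[OF M' q'] sets_bind'[OF M' q'] by auto
  interpret B: prob_space ?B by fact
  \<comment> \<open>A probability measure on a countable set lives on its atoms, as the type of
    sequences of coefficients requires.\<close>
  have "\<exists>S. countable S \<and> (AE x in ?B. x \<in> S)"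
    by (intro exI[of _ UNIV]) auto
  then have "AE x in ?B. measure ?B {x} \<noteq> 0"
    using B.AE_support_countable[OF s] by blast
  then show ?thesis unfolding mean_pmf_def using p s by (subst Abs_pmf_inverse) auto
qed

lemma mean_pmf_cong:
  "(\<And>\<omega>. \<omega> \<in> space M \<Longrightarrow> q \<omega> = r \<omega>) \<Longrightarrow> mean_pmf M q = mean_pmf M r"
  unfolding mean_pmf_def by (simp cong: bind_cong)

lemma mean_pmf_measure_pmf: "mean_pmf (measure_pmf p) q = bind_pmf p q"
  unfolding mean_pmf_def by (simp add: measure_pmf_bind[symmetric] measure_pmf_inverse)

lemma mean_pmf_return:
  assumes x: "x \<in> space M" and q: "q \<in> M \<rightarrow>\<^sub>M GirySeq"
  shows "mean_pmf (return M x) q = q x"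
  unfolding mean_pmf_def
  using measurable_prob_algebraD[OF q[unfolded measurable_GirySeq_iff]] x
  by (subst bind_return) (auto simp: measure_pmf_inverse)

lemma mean_pmf_distr:
  assumes "prob_space M" and g: "g \<in> M \<rightarrow>\<^sub>M N" and q: "q \<in> N \<rightarrow>\<^sub>M GirySeq"
  shows "mean_pmf (distr M N g) q = mean_pmf M (\<lambda>\<omega>. q (g \<omega>))"
  unfolding mean_pmf_def
  using measurable_prob_algebraD[OF q[unfolded measurable_GirySeq_iff]]
    prob_space.not_empty[OF assms(1)]
  by (subst bind_distr[OF g]) auto

text \<open>
  Read as measures, both sides are iterated binds, and the claim is the associativity of bind.
\<close>
lemma mean_pmf_bind:
  assumes Q: "Q \<in> space (prob_algebra N)" and K: "K \<in> N \<rightarrow>\<^sub>M prob_algebra M"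
    and q: "q \<in> M \<rightarrow>\<^sub>M GirySeq"
  shows "mean_pmf (Q \<bind> K) q = mean_pmf Q (\<lambda>\<omega>. mean_pmf (K \<omega>) q)"
proof -
  have sQ: "sets Q = sets N" using Q by (simp add: space_prob_algebra)
  have K': "K \<in> Q \<rightarrow>\<^sub>M subprob_algebra M"
    using measurable_prob_algebraD[OF K] sQ by (simp cong: measurable_cong_sets)
  have in_K: "measure_pmf (mean_pmf (K \<omega>) q) = K \<omega> \<bind> (\<lambda>y. measure_pmf (q y))"
    if "\<omega> \<in> space Q" for \<omega>
  proof -
    have K\<omega>: "prob_space (K \<omega>)" "sets (K \<omega>) = sets M"
      using measurable_space[OF K] that sets_eq_imp_space_eq[OF sQ]
      by (auto simp: space_prob_algebra)
    then show ?thesis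
      using q by (intro measure_mean_pmf) (simp_all cong: measurable_cong_sets)
  qed
  show ?thesis
    unfolding mean_pmf_def[of "Q \<bind> K"] mean_pmf_def[of Q]
      bind_assoc[OF K' measurable_prob_algebraD[OF q[unfolded measurable_GirySeq_iff]]]
    by (simp add: in_K cong: bind_cong)
qed

lemma measurable_mean_pmf:
  assumes q: "q \<in> M \<rightarrow>\<^sub>M GirySeq"
  shows "(\<lambda>P. mean_pmf P q) \<in> prob_algebra M \<rightarrow>\<^sub>M GirySeq"
  unfolding measurable_GirySeq_iff
proof (subst measurable_cong)
  fix P assume "P \<in> space (prob_algebra M)"
  then have "prob_space P" "sets P = sets M" by (auto simp: space_prob_algebra)
  then show "measure_pmf (mean_pmf P q) = P \<bind> (\<lambda>\<omega>. measure_pmf (q \<omega>))"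
    using q by (intro measure_mean_pmf) (simp_all cong: measurable_cong_sets)
next
  show "(\<lambda>P. P \<bind> (\<lambda>\<omega>. measure_pmf (q \<omega>)))
      \<in> prob_algebra M \<rightarrow>\<^sub>M prob_algebra (count_space UNIV)"
    using q[unfolded measurable_GirySeq_iff]
    by (intro measurable_bind_prob_space[OF measurable_ident_sets]) auto
qed

section \<open>Countably affine maps between the two test spaces\<close>

lemma hom_csum:
  "g \<in> hom_scvx B C \<Longrightarrow> pts B = UNIV \<Longrightarrow> g (csum B p u) = csum C p (\<lambda>i. g (u i))"
  unfolding hom_scvx_def countably_affine_def by auto

text \<open>
  The unit masses generate $\Delta_{\mathbb{N}}$: every \<open>p\<close> is the sum of the $\delta_i$ with
  coefficients $p_i$.
\<close>
lemma hom_DeltaN_csum: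
  assumes "g \<in> hom_scvx DeltaN C"
  shows "g p = csum C p (\<lambda>i. g (return_pmf i))"
  using hom_csum[OF assms, of p return_pmf] by (simp add: DeltaN_def bind_return_pmf')

lemma measurable_into_GirySeq_discrete: "q \<in> count_space UNIV \<rightarrow>\<^sub>M GirySeq"
  by (simp add: GirySeq_def)

text \<open>
  The law of a random natural number as a sequence of coefficients. It turns averages over a
  general probability space into countable sums, which affine maps respect by definition.
\<close>
lemma law_pmf:
  fixes u :: "'w \<Rightarrow> nat"
  assumes M: "prob_space M" and u: "u \<in> M \<rightarrow>\<^sub>M count_space UNIV"
  obtains p where "measure_pmf p = distr M (count_space UNIV) u"
proof
  have "(\<lambda>\<omega>. return_pmf (u \<omega>)) \<in> M \<rightarrow>\<^sub>M GirySeq"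
    by (rule measurable_compose[OF u measurable_into_GirySeq_discrete])
  then have "measure_pmf (mean_pmf M (\<lambda>\<omega>. return_pmf (u \<omega>)))
      = M \<bind> (\<lambda>\<omega>. return (count_space UNIV) (u \<omega>))"
    by (simp add: measure_mean_pmf[OF M] return_pmf.rep_eq)
  then show "measure_pmf (mean_pmf M (\<lambda>\<omega>. return_pmf (u \<omega>))) = distr M (count_space UNIV) u"
    by (simp add: bind_return_distr'[OF prob_space.not_empty[OF M] u])
qed

lemma ess_min_hom_NatMin:
  assumes M: "prob_space M" and u: "u \<in> M \<rightarrow>\<^sub>M count_space UNIV"
    and g: "g \<in> hom_scvx NatMin NatMin"
  shows "ess_min M (\<lambda>\<omega>. g (u \<omega>)) = g (ess_min M u)"
proof -
  obtain p where p: "measure_pmf p = distr M (count_space UNIV) u"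
    using law_pmf[OF M u] .
  have law: "ess_min M (\<lambda>\<omega>. h (u \<omega>)) = csum NatMin p h" for h
    using ess_min_distr[OF u, of h] by (simp add: p[symmetric] ess_min_pmf)
  show ?thesis
    using hom_csum[OF g, of p "\<lambda>i. i"] law[of g] law[of "\<lambda>i. i"] by (simp add: NatMin_def)
qed

lemma mean_pmf_hom_NatMin:
  assumes M: "prob_space M" and u: "u \<in> M \<rightarrow>\<^sub>M count_space UNIV"
    and g: "g \<in> hom_scvx NatMin DeltaN"
  shows "mean_pmf M (\<lambda>\<omega>. g (u \<omega>)) = g (ess_min M u)"
proof -
  obtain p where p: "measure_pmf p = distr M (count_space UNIV) u"
    using law_pmf[OF M u] .
  have "mean_pmf M (\<lambda>\<omega>. g (u \<omega>)) = csum DeltaN p g"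
    using mean_pmf_distr[OF M u measurable_into_GirySeq_discrete, of g]
    by (simp add: p[symmetric] mean_pmf_measure_pmf DeltaN_def)
  also have "\<dots> = g (csum NatMin p (\<lambda>i. i))"
    using hom_csum[OF g, of p "\<lambda>i. i"] by (simp add: NatMin_def)
  also have "csum NatMin p (\<lambda>i. i) = ess_min M u"
    using ess_min_distr[OF u, of "\<lambda>i. i"] by (simp add: p[symmetric] ess_min_pmf)
  finally show ?thesis .
qed

text \<open>
  A random sequence of coefficients may take uncountably many values, so its mean is not a countable
  sum that \<open>g\<close> respects by definition. But \<open>g p\<close> is the essential minimum of the numbers \<open>g (return_pmf i)\<close> under \<open>p\<close>, so the claim is an instance of
  \<open>ess_min_bind\<close> with the kernel \<open>q\<close>.
\<close>
lemma ess_min_hom_DeltaN: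
  assumes M: "prob_space M" and q: "q \<in> M \<rightarrow>\<^sub>M GirySeq"
    and g: "g \<in> hom_scvx DeltaN NatMin"
  shows "ess_min M (\<lambda>\<omega>. g (q \<omega>)) = g (mean_pmf M q)"
proof -
  define \<gamma> where "\<gamma> = (\<lambda>i. g (return_pmf i))"
  have g': "g p = ess_min (measure_pmf p) \<gamma>" for p
    using hom_DeltaN_csum[OF g, of p] by (simp add: ess_min_pmf \<gamma>_def)
  have M': "M \<in> space (prob_algebra M)" using M by (simp add: space_prob_algebra)
  show ?thesis
    unfolding g' measure_mean_pmf[OF M q]
    by (rule ess_min_bind[OF M' q[unfolded measurable_GirySeq_iff], symmetric]) simp
qed

text \<open>
  As for \<open>ess_min_hom_DeltaN\<close>: \<open>g p\<close> is the mean of the sequences \<open>g (return_pmf i)\<close> under \<open>p\<close>.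
\<close>
lemma mean_pmf_hom_DeltaN:
  assumes M: "prob_space M" and q: "q \<in> M \<rightarrow>\<^sub>M GirySeq"
    and g: "g \<in> hom_scvx DeltaN DeltaN"
  shows "mean_pmf M (\<lambda>\<omega>. g (q \<omega>)) = g (mean_pmf M q)"
proof -
  define \<gamma> where "\<gamma> = (\<lambda>i. g (return_pmf i))"
  have g': "g p = mean_pmf (measure_pmf p) \<gamma>" for p
    using hom_DeltaN_csum[OF g, of p] by (simp add: mean_pmf_measure_pmf \<gamma>_def DeltaN_def)
  have M': "M \<in> space (prob_algebra M)" using M by (simp add: space_prob_algebra)
  show ?thesis
    unfolding g' measure_mean_pmf[OF M q]
    by (rule mean_pmf_bind[OF M' q[unfolded measurable_GirySeq_iff]
          measurable_into_GirySeq_discrete, symmetric])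
qed

section \<open>Averaging random points of the limit\<close>

text \<open>
  The average is taken of a random point \<open>x\<close> over any probability space, and not only of the
  identity over measures on the limit, so that one operation covers the barycenter, the sums of the
  limit (over \<open>measure_pmf p\<close>) and the average of the barycenters in the multiplication law.
\<close>
definition average :: "'a scvx \<Rightarrow> 'w measure \<Rightarrow> ('w \<Rightarrow> 'a family) \<Rightarrow> 'a family" where
  "average A M x =
     (\<lambda>f\<in>hom_scvx A NatMin. ess_min M (\<lambda>\<omega>. fst (x \<omega>) f),
      \<lambda>f\<in>hom_scvx A DeltaN. mean_pmf M (\<lambda>\<omega>. snd (x \<omega>) f))"

lemma space_Ran:
  "x \<in> space (Ran A) \<longleftrightarrow>
     fst x \<in> extensional (hom_scvx A NatMin) \<and> snd x \<in> extensional (hom_scvx A DeltaN) \<and>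
     compatible A x"
  by (simp add: Ran_def space_restrict_space space_pair_measure space_PiM GirySeq_def
      mem_Times_iff PiE_def conj_ac)

lemma measurable_fst_component:
  "f \<in> hom_scvx A NatMin \<Longrightarrow> (\<lambda>x. fst x f) \<in> Ran A \<rightarrow>\<^sub>M count_space UNIV"
  unfolding Ran_def
  by (intro measurable_restrict_space1 measurable_compose[OF measurable_fst]
      measurable_component_singleton)

lemma measurable_snd_component:
  "f \<in> hom_scvx A DeltaN \<Longrightarrow> (\<lambda>x. snd x f) \<in> Ran A \<rightarrow>\<^sub>M GirySeq"
  unfolding Ran_def
  by (intro measurable_restrict_space1 measurable_compose[OF measurable_snd]
      measurable_component_singleton)

text \<open>
  Compatibility has one clause for each of the four kinds of morphisms between the test spaces; each
  is the fact that these morphisms commute with averaging.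
\<close>
lemma average_in_Ran:
  assumes A: "super_convex_space A" and M: "prob_space M" and x: "x \<in> M \<rightarrow>\<^sub>M Ran A"
  shows "average A M x \<in> space (Ran A)"
proof -
  have c: "compatible A (x \<omega>)" if "\<omega> \<in> space M" for \<omega>
    using measurable_space[OF x that] by (simp add: space_Ran)
  note m1 = measurable_compose[OF x measurable_fst_component]
  note m2 = measurable_compose[OF x measurable_snd_component]
  have "compatible A (average A M x)"
    unfolding compatible_def
  proof (intro conjI ballI)
    fix f g assume f: "f \<in> hom_scvx A NatMin" and g: "g \<in> hom_scvx NatMin NatMin"
    have "ess_min M (\<lambda>\<omega>. fst (x \<omega>) (compose (pts A) g f)) = ess_min M (\<lambda>\<omega>. g (fst (x \<omega>) f))"
      using c f g by (intro ess_min_cong) (auto simp: compatible_def)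
    then show "fst (average A M x) (compose (pts A) g f) = g (fst (average A M x) f)"
      by (simp add: average_def f compose_hom_scvx[OF A f g] ess_min_hom_NatMin[OF M m1 g])
  next
    fix f g assume f: "f \<in> hom_scvx A NatMin" and g: "g \<in> hom_scvx NatMin DeltaN"
    have "mean_pmf M (\<lambda>\<omega>. snd (x \<omega>) (compose (pts A) g f)) = mean_pmf M (\<lambda>\<omega>. g (fst (x \<omega>) f))"
      using c f g by (intro mean_pmf_cong) (auto simp: compatible_def)
    then show "snd (average A M x) (compose (pts A) g f) = g (fst (average A M x) f)"
      by (simp add: average_def f compose_hom_scvx[OF A f g] mean_pmf_hom_NatMin[OF M m1 g])
  next
    fix f g assume f: "f \<in> hom_scvx A DeltaN" and g: "g \<in> hom_scvx DeltaN NatMin"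
    have "ess_min M (\<lambda>\<omega>. fst (x \<omega>) (compose (pts A) g f)) = ess_min M (\<lambda>\<omega>. g (snd (x \<omega>) f))"
      using c f g by (intro ess_min_cong) (auto simp: compatible_def)
    then show "fst (average A M x) (compose (pts A) g f) = g (snd (average A M x) f)"
      by (simp add: average_def f compose_hom_scvx[OF A f g] ess_min_hom_DeltaN[OF M m2 g])
  next
    fix f g assume f: "f \<in> hom_scvx A DeltaN" and g: "g \<in> hom_scvx DeltaN DeltaN"
    have "mean_pmf M (\<lambda>\<omega>. snd (x \<omega>) (compose (pts A) g f)) = mean_pmf M (\<lambda>\<omega>. g (snd (x \<omega>) f))"
      using c f g by (intro mean_pmf_cong) (auto simp: compatible_def)
    then show "snd (average A M x) (compose (pts A) g f) = g (snd (average A M x) f)"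
      by (simp add: average_def f compose_hom_scvx[OF A f g] mean_pmf_hom_DeltaN[OF M m2 g])
  qed
  then show ?thesis by (simp add: space_Ran average_def)
qed

lemma measurable_average:
  assumes A: "super_convex_space A" and x: "x \<in> M \<rightarrow>\<^sub>M Ran A"
  shows "(\<lambda>P. average A P x) \<in> prob_algebra M \<rightarrow>\<^sub>M Ran A"
proof -
  have in_Ran: "average A P x \<in> space (Ran A)" if "P \<in> space (prob_algebra M)" for P
    using that x by (intro average_in_Ran[OF A])
      (auto simp: space_prob_algebra cong: measurable_cong_sets)
  have m: "(\<lambda>P. average A P x) \<in> prob_algebra M \<rightarrow>\<^sub>M
      ((\<Pi>\<^sub>M f\<in>hom_scvx A NatMin. count_space UNIV) \<Otimes>\<^sub>M (\<Pi>\<^sub>M f\<in>hom_scvx A DeltaN. GirySeq))"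
    unfolding average_def
    by (intro measurable_Pair measurable_restrict measurable_ess_min measurable_mean_pmf
        measurable_compose[OF x measurable_fst_component]
        measurable_compose[OF x measurable_snd_component])
  show ?thesis
    unfolding Ran_def
    by (intro measurable_restrict_space2 m) (use in_Ran in \<open>auto simp: space_Ran\<close>)
qed

lemma average_return:
  assumes y: "y \<in> space M" and x: "x \<in> M \<rightarrow>\<^sub>M Ran A"
  shows "average A (return M y) x = x y"
proof -
  have ext: "fst (x y) \<in> extensional (hom_scvx A NatMin)"
      "snd (x y) \<in> extensional (hom_scvx A DeltaN)"
    using measurable_space[OF x y] by (auto simp: space_Ran)
  have "average A (return M y) x =
      (restrict (fst (x y)) (hom_scvx A NatMin), restrict (snd (x y)) (hom_scvx A DeltaN))"
    unfolding average_def prod.inject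
    by (intro conjI restrict_ext
        ess_min_return[OF y measurable_compose[OF x measurable_fst_component]]
        mean_pmf_return[OF y measurable_compose[OF x measurable_snd_component]])
  then show ?thesis by (simp add: extensional_restrict ext)
qed

lemma average_distr:
  assumes "prob_space M" and g: "g \<in> M \<rightarrow>\<^sub>M N" and x: "x \<in> N \<rightarrow>\<^sub>M Ran A"
  shows "average A (distr M N g) x = average A M (\<lambda>\<omega>. x (g \<omega>))"
  unfolding average_def prod.inject
  by (intro conjI restrict_ext
      ess_min_distr[OF g measurable_compose[OF x measurable_fst_component]]
      mean_pmf_distr[OF assms(1) g measurable_compose[OF x measurable_snd_component]])

lemma average_bind:
  assumes Q: "Q \<in> space (prob_algebra N)" and K: "K \<in> N \<rightarrow>\<^sub>M prob_algebra M"
    and x: "x \<in> M \<rightarrow>\<^sub>M Ran A"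
  shows "average A (Q \<bind> K) x = average A Q (\<lambda>\<omega>. average A (K \<omega>) x)"
  by (auto simp: average_def
      ess_min_bind[OF Q K measurable_compose[OF x measurable_fst_component]]
      mean_pmf_bind[OF Q K measurable_compose[OF x measurable_snd_component]]
      intro!: restrict_ext)

lemma average_pmf: "average A (measure_pmf p) x = csum (Ran_scvx A) p x"
  by (simp add: average_def Ran_scvx_def ess_min_pmf mean_pmf_measure_pmf DeltaN_def)

section \<open>Multiplication and sums of probability measures\<close>

text \<open>
  The integral formula for the multiplication is that of the bind along the identity kernel, which
  is a kernel because elements of the base space of \<open>Q\<close> are themselves measures on \<open>M\<close>.
\<close>
lemma giry_mult_eq_bind:
  assumes Q: "Q \<in> space (prob_algebra (prob_algebra M))"
  shows "giry_mult M Q = Q \<bind> (\<lambda>P. P)"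
proof -
  let ?B = "Q \<bind> (\<lambda>P. P)"
  have K: "(\<lambda>P. P) \<in> prob_algebra M \<rightarrow>\<^sub>M prob_algebra M" by simp
  have s: "sets ?B = sets M" by (rule sets_bind'[OF Q K])
  have "giry_mult M Q = measure_of (space M) (sets M) (emeasure ?B)"
    unfolding giry_mult_def
    by (rule measure_of_eq[OF sets.space_closed])
       (simp add: sets.sigma_sets_eq emeasure_bind_prob_algebra[OF Q K])
  also have "\<dots> = ?B"
    using measure_of_of_measure[of ?B] by (simp add: s sets_eq_imp_space_eq[OF s])
  finally show ?thesis .
qed

lemma pmf_in_prob_algebra: "measure_pmf p \<in> space (prob_algebra (count_space UNIV))"
  by (simp add: space_prob_algebra measure_pmf.prob_space_axioms)

text \<open>
  A countable convex combination of measures is the mixture along the kernel \<open>P\<close> on the natural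
  numbers, an integral against \<open>p\<close> being a series.
\<close>
lemma Giry_csum_eq_bind:
  assumes P: "P \<in> UNIV \<rightarrow> space (prob_algebra M)"
  shows "csum (Giry_scvx M) p P = measure_pmf p \<bind> P"
proof -
  let ?B = "measure_pmf p \<bind> P"
  have K: "P \<in> count_space UNIV \<rightarrow>\<^sub>M prob_algebra M" using P by simp
  have s: "sets ?B = sets M" by (rule sets_bind'[OF pmf_in_prob_algebra K])
  have "csum (Giry_scvx M) p P = measure_of (space M) (sets M) (emeasure ?B)"
    unfolding Giry_scvx_def scvx.select_convs
  proof (rule measure_of_eq[OF sets.space_closed])
    fix U assume "U \<in> sigma_sets (space M) (sets M)"
    then have U: "U \<in> sets M" by (simp add: sets.sigma_sets_eq)
    have "emeasure ?B U = (\<integral>\<^sup>+ i. emeasure (P i) U \<partial>measure_pmf p)"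
      by (rule emeasure_bind_prob_algebra[OF pmf_in_prob_algebra K U])
    also have "\<dots> = (\<Sum>i. ennreal (pmf p i) * emeasure (P i) U)"
      by (simp add: nn_integral_measure_pmf nn_integral_count_space_nat)
    finally show "(\<Sum>i. ennreal (pmf p i) * emeasure (P i) U) = emeasure ?B U" ..
  qed
  also have "\<dots> = ?B"
    using measure_of_of_measure[of ?B] by (simp add: s sets_eq_imp_space_eq[OF s])
  finally show ?thesis .
qed

section \<open>The barycenter map\<close>

lemma Ran_barycenter:
  assumes A: "super_convex_space A"
  defines "\<epsilon> \<equiv> \<lambda>P. average A P (\<lambda>x. x)"
  shows "\<epsilon> \<in> prob_algebra (Ran A) \<rightarrow>\<^sub>M Ran A"
    and "barycenter_unit (Ran A) \<epsilon>"
    and "barycenter_mult (Ran A) \<epsilon>"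
    and "countably_affine (Giry_scvx (Ran A)) (Ran_scvx A) \<epsilon>"
proof -
  show m: "\<epsilon> \<in> prob_algebra (Ran A) \<rightarrow>\<^sub>M Ran A"
    unfolding \<epsilon>_def by (rule measurable_average[OF A]) simp
  show "barycenter_unit (Ran A) \<epsilon>"
    unfolding barycenter_unit_def \<epsilon>_def by (simp add: average_return)
  show "barycenter_mult (Ran A) \<epsilon>"
    unfolding barycenter_mult_def
  proof
    fix Q assume Q: "Q \<in> space (prob_algebra (prob_algebra (Ran A)))"
    then have Q': "prob_space Q" "sets Q = sets (prob_algebra (Ran A))"
      by (auto simp: space_prob_algebra)
    have "\<epsilon> \<in> Q \<rightarrow>\<^sub>M Ran A" using m Q'(2) by (simp cong: measurable_cong_sets)
    then have "\<epsilon> (distr Q (Ran A) \<epsilon>) = average A Q \<epsilon>"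
      unfolding \<epsilon>_def by (intro average_distr[OF Q'(1)]) simp_all
    also have "\<dots> = \<epsilon> (Q \<bind> (\<lambda>P. P))"
      unfolding \<epsilon>_def by (rule average_bind[OF Q measurable_ident measurable_ident, unfolded id_def, symmetric])
    finally show "\<epsilon> (distr Q (Ran A) \<epsilon>) = \<epsilon> (giry_mult (Ran A) Q)"
      by (simp add: giry_mult_eq_bind[OF Q])
  qed
  show "countably_affine (Giry_scvx (Ran A)) (Ran_scvx A) \<epsilon>"
    unfolding countably_affine_def
  proof (intro conjI allI ballI)
    show "\<epsilon> \<in> pts (Giry_scvx (Ran A)) \<rightarrow> pts (Ran_scvx A)"
      using measurable_space[OF m] by (simp add: Giry_scvx_def Ran_scvx_def)
    fix p and P :: "nat \<Rightarrow> 'a family measure" assume "P \<in> UNIV \<rightarrow> pts (Giry_scvx (Ran A))"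
    then have P: "P \<in> UNIV \<rightarrow> space (prob_algebra (Ran A))" by (simp add: Giry_scvx_def)
    then have "\<epsilon> (measure_pmf p \<bind> P) = average A (measure_pmf p) (\<lambda>i. \<epsilon> (P i))"
      unfolding \<epsilon>_def by (intro average_bind[OF pmf_in_prob_algebra, where M = "Ran A"]) simp_all
    then show "\<epsilon> (csum (Giry_scvx (Ran A)) p P) = csum (Ran_scvx A) p (\<lambda>i. \<epsilon> (P i))"
      by (simp add: Giry_csum_eq_bind[OF P] average_pmf)
  qed
qed

text \<open>
  The comparison map \<open>c\<close> is an isomorphism of measurable spaces with inverse \<open>d\<close>, and push-forward
  along it, \<open>C\<close>, is one on probability measures; the structure map is conjugated by these. Pushing
  forward commutes with binds, hence with the multiplication and with sums of measures, and \<open>c\<close>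
  respects the sums of points.
\<close>
lemma Sigma_barycenter:
  assumes A: "super_convex_space A" and "identified A"
    and m: "\<epsilon> \<in> prob_algebra (Ran A) \<rightarrow>\<^sub>M Ran A"
    and unit: "barycenter_unit (Ran A) \<epsilon>"
    and mult: "barycenter_mult (Ran A) \<epsilon>"
    and aff: "countably_affine (Giry_scvx (Ran A)) (Ran_scvx A) \<epsilon>"
  shows "\<exists>\<epsilon>' \<in> prob_algebra (Sigma_space A) \<rightarrow>\<^sub>M Sigma_space A.
           barycenter_unit (Sigma_space A) \<epsilon>' \<and>
           barycenter_mult (Sigma_space A) \<epsilon>' \<and>
           countably_affine (Giry_scvx (Sigma_space A)) A \<epsilon>'"
proof -
  let ?R = "Ran A" and ?S = "Sigma_space A"
  define c where "c = comparison A"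
  define d where "d = inv_into (pts A) c"
  have bij: "bij_betw c (pts A) (space ?R)"
    using assms(2) by (simp add: identified_def c_def)
  have spS: "space ?S = pts A" by (simp add: Sigma_space_def)
  have cd: "c (d x) = x" if "x \<in> space ?R" for x
    unfolding d_def using bij_betw_inv_into_right[OF bij that] .
  have dc: "d (c a) = a" if "a \<in> pts A" for a
    unfolding d_def using bij_betw_inv_into_left[OF bij that] .
  have c_in: "c a \<in> space ?R" if "a \<in> pts A" for a using bij_betwE[OF bij] that by blast
  have d_in: "d x \<in> pts A" if "x \<in> space ?R" for x
    using bij_betwE[OF bij_betw_inv_into[OF bij]] that by (auto simp: d_def)
  have mc: "c \<in> ?S \<rightarrow>\<^sub>M ?R"
    unfolding Sigma_space_def c_def[symmetric] using c_in by (intro measurable_vimage_algebra1) auto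
  have md: "d \<in> ?R \<rightarrow>\<^sub>M ?S"
    unfolding Sigma_space_def c_def[symmetric] using d_in
    by (intro measurable_vimage_algebra2) (auto simp: cd cong: measurable_cong)
  define C where "C = (\<lambda>P. distr P ?R c)"
  have mC: "C \<in> prob_algebra ?S \<rightarrow>\<^sub>M prob_algebra ?R"
    unfolding C_def by (rule measurable_distr_prob_space[OF mc])
  define h where "h = (\<lambda>P. d (\<epsilon> (C P)))"
  have m\<epsilon>C: "(\<lambda>P. \<epsilon> (C P)) \<in> prob_algebra ?S \<rightarrow>\<^sub>M ?R"
    by (rule measurable_compose[OF mC m])
  have mh: "h \<in> prob_algebra ?S \<rightarrow>\<^sub>M ?S"
    unfolding h_def by (rule measurable_compose[OF m\<epsilon>C md])
  have ch: "c (h P) = \<epsilon> (C P)" if "P \<in> space (prob_algebra ?S)" for P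
    unfolding h_def by (rule cd[OF measurable_space[OF m\<epsilon>C that]])
  have C_bind: "C (Q \<bind> K) = Q \<bind> (\<lambda>\<omega>. C (K \<omega>))"
    if Q: "Q \<in> space (prob_algebra N)" and K: "K \<in> N \<rightarrow>\<^sub>M prob_algebra ?S"
    for Q :: "'z measure" and K N
  proof -
    have "prob_space Q" "sets Q = sets N" using Q by (auto simp: space_prob_algebra)
    then show ?thesis
      unfolding C_def using measurable_prob_algebraD[OF K] prob_space.not_empty[of Q]
      by (intro distr_bind[OF _ _ mc]) (auto cong: measurable_cong_sets)
  qed
  have "barycenter_unit ?S h"
    unfolding barycenter_unit_def
  proof
    fix a assume a: "a \<in> space ?S"
    then have "C (return ?S a) = return ?R (c a)"
      unfolding C_def by (rule distr_return[OF mc])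
    then show "h (return ?S a) = a"
      using unit a c_in dc by (simp add: h_def barycenter_unit_def spS)
  qed
  moreover have "barycenter_mult ?S h"
    unfolding barycenter_mult_def
  proof
    fix Q assume Q: "Q \<in> space (prob_algebra (prob_algebra ?S))"
    then have Q': "prob_space Q" "sets Q = sets (prob_algebra ?S)"
      by (auto simp: space_prob_algebra)
    note spQ = sets_eq_imp_space_eq[OF Q'(2)]
    have mC': "C \<in> Q \<rightarrow>\<^sub>M prob_algebra ?R" and mh': "h \<in> Q \<rightarrow>\<^sub>M ?S"
      using mC mh Q'(2) by (simp_all cong: measurable_cong_sets)
    \<comment> \<open>\<open>Q1\<close> is the image of \<open>Q\<close> among the measures on measures on the limit. The two sides of
      the law for \<open>Q\<close> are carried by \<open>C\<close> to the two sides of the law for \<open>Q1\<close>.\<close>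
    define Q1 where "Q1 = distr Q (prob_algebra ?R) C"
    have Q1: "Q1 \<in> space (prob_algebra (prob_algebra ?R))"
      unfolding Q1_def using prob_space.prob_space_distr[OF Q'(1) mC']
      by (simp add: space_prob_algebra)
    have "C (distr Q ?S h) = distr Q ?R (\<lambda>P. c (h P))"
      unfolding C_def by (subst distr_distr[OF mc mh']) (simp add: comp_def)
    also have "\<dots> = distr Q ?R (\<lambda>P. \<epsilon> (C P))"
      by (rule distr_cong) (simp_all add: ch spQ)
    also have "\<dots> = distr Q1 ?R \<epsilon>"
      unfolding Q1_def by (subst distr_distr[OF m mC']) (simp add: comp_def)
    finally have 1: "C (distr Q ?S h) = distr Q1 ?R \<epsilon>" .
    have "C (giry_mult ?S Q) = Q \<bind> C"
      by (simp add: giry_mult_eq_bind[OF Q] C_bind[OF Q])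
    also have "\<dots> = Q1 \<bind> (\<lambda>P. P)"
      unfolding Q1_def
      by (rule bind_distr[OF mC' measurable_prob_algebraD[OF measurable_ident, unfolded id_def], symmetric])
        (simp add: prob_space.not_empty[OF Q'(1)])
    finally have 2: "C (giry_mult ?S Q) = giry_mult ?R Q1"
      by (simp add: giry_mult_eq_bind[OF Q1])
    have h: "h P = d (\<epsilon> (C P))" for P by (simp add: h_def)
    show "h (distr Q ?S h) = h (giry_mult ?S Q)"
      unfolding h[of "distr Q ?S h"] h[of "giry_mult ?S Q"] 1 2
      using mult Q1 by (simp add: barycenter_mult_def)
  qed
  moreover have "countably_affine (Giry_scvx ?S) A h"
    unfolding countably_affine_def
  proof (intro conjI allI ballI)
    show "h \<in> pts (Giry_scvx ?S) \<rightarrow> pts A"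
      using measurable_space[OF mh] by (simp add: Giry_scvx_def spS)
    fix p and P :: "nat \<Rightarrow> 'a measure" assume "P \<in> UNIV \<rightarrow> pts (Giry_scvx ?S)"
    then have P: "P \<in> UNIV \<rightarrow> space (prob_algebra ?S)" by (simp add: Giry_scvx_def)
    then have Pi: "P i \<in> space (prob_algebra ?S)" for i by blast
    have CP: "(\<lambda>i. C (P i)) \<in> UNIV \<rightarrow> space (prob_algebra ?R)"
      using measurable_space[OF mC Pi] by blast
    have hP: "(\<lambda>i. h (P i)) \<in> UNIV \<rightarrow> pts A"
      using measurable_space[OF mh Pi] by (simp add: spS)
    have "C (csum (Giry_scvx ?S) p P) = csum (Giry_scvx ?R) p (\<lambda>i. C (P i))"
      using P by (simp add: Giry_csum_eq_bind[OF P] Giry_csum_eq_bind[OF CP]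
          C_bind[OF pmf_in_prob_algebra])
    then have "h (csum (Giry_scvx ?S) p P) = d (\<epsilon> (csum (Giry_scvx ?R) p (\<lambda>i. C (P i))))"
      by (simp add: h_def)
    also have "\<dots> = d (csum (Ran_scvx A) p (\<lambda>i. \<epsilon> (C (P i))))"
      using aff CP by (simp add: countably_affine_def Giry_scvx_def)
    also have "\<dots> = d (csum (Ran_scvx A) p (\<lambda>i. c (h (P i))))"
      by (simp add: ch[OF Pi])
    also have "\<dots> = d (c (csum A p (\<lambda>i. h (P i))))"
      using countably_affine_comparison[OF A] hP by (simp add: countably_affine_def c_def)
    also have "\<dots> = csum A p (\<lambda>i. h (P i))"
      by (rule dc[OF csum_closed[OF A hP]])
    finally show "h (csum (Giry_scvx ?S) p P) = csum A p (\<lambda>i. h (P i))" .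
  qed
  ultimately show ?thesis using mh by blast
qed

lemma restrict_eq_iff: "restrict f X = restrict g X \<longleftrightarrow> (\<forall>x\<in>X. f x = g x)"
  by (metis restrict_apply' restrict_ext)

lemma barycenter_laws_iff_giry_algebra:
  assumes "\<epsilon> \<in> prob_algebra M \<rightarrow>\<^sub>M M"
  shows "barycenter_unit M \<epsilon> \<and> barycenter_mult M \<epsilon> \<longleftrightarrow> giry_algebra M \<epsilon>"
  using assms
  by (simp add: giry_algebra_def barycenter_unit_def barycenter_mult_def restrict_eq_iff)

theorem lemma7p1:
  fixes A :: "'a scvx"
  assumes "SCvx_star A"
  shows "(identified A \<longrightarrow>
            (\<exists>\<epsilon> \<in> prob_algebra (Sigma_space A) \<rightarrow>\<^sub>M Sigma_space A.
               barycenter_unit (Sigma_space A) \<epsilon> \<and>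
               barycenter_mult (Sigma_space A) \<epsilon> \<and>
               countably_affine (Giry_scvx (Sigma_space A)) A \<epsilon>)) \<and>
         (\<exists>\<epsilon> \<in> prob_algebra (Ran A) \<rightarrow>\<^sub>M Ran A.
            barycenter_unit (Ran A) \<epsilon> \<and>
            barycenter_mult (Ran A) \<epsilon> \<and>
            countably_affine (Giry_scvx (Ran A)) (Ran_scvx A) \<epsilon>) \<and>
         (\<forall>\<epsilon> \<in> prob_algebra (Sigma_space A) \<rightarrow>\<^sub>M Sigma_space A.
            barycenter_unit (Sigma_space A) \<epsilon> \<and> barycenter_mult (Sigma_space A) \<epsilon> \<longleftrightarrow>
            giry_algebra (Sigma_space A) \<epsilon>)"
proof -
  have A: "super_convex_space A" using assms by (simp add: SCvx_star_def)
  note R = Ran_barycenter[OF A]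
  show ?thesis
    using Sigma_barycenter[OF A _ R] R barycenter_laws_iff_giry_algebra by blast
qed

end
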